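(* Let $n\ge 1$, let $X_1,\ldots,X_n$ be nonnegative integrable real random variables, and let $\tilde X_1,\ldots,\tilde X_n$ be mutually independent random variables such that each $\tilde X_i$ has the same distribution as $X_i$. If the $X_i$ are pairwise independent, then $$\mathbb{E}\max_{1\le i\le n}X_i\ \ge\ \frac12\,\mathbb{E}\max_{1\le i\le n}\tilde X_i.$$ *)

theory Defs
  imports "HOL-Probability.Probability"
begin

end

theory Submission
  imports Defs
begin

text \<open>
  Compare the tails of the two maxima. If \<open>s\<close> is the sum of the probabilities of the events
  \<open>X\<^sub>i > t\<close>, the second moment method, which only sees pairwise intersections, shows that their
  union has probability at least \<open>s / (1 + s)\<close>, while the union bound gives \<open>min 1 s\<close> as an upper
  bound for the tail of the independent copies. As \<open>min 1 s \<le> 2 s / (1 + s)\<close>, integrating over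
  \<open>t\<close> gives the claim.
\<close>

text \<open>Let \<open>S\<close> count the events that occur and let \<open>U\<close> be their
  union. A multiple of the indicator of \<open>U\<close> is compared with \<open>S\<close> in mean
  square; expanding the square involves only first moments and pairwise intersections, so pairwise
  independence suffices. The product form avoids a division.\<close>

lemma (in prob_space) sum_prob_le_prob_Union_pairwise:
  assumes "finite I" and A: "\<And>i. i \<in> I \<Longrightarrow> A i \<in> events"
    and indep: "\<And>i j. i \<in> I \<Longrightarrow> j \<in> I \<Longrightarrow> i \<noteq> j \<Longrightarrow> prob (A i \<inter> A j) = prob (A i) * prob (A j)"
  shows "(\<Sum>i\<in>I. prob (A i)) \<le> (1 + (\<Sum>i\<in>I. prob (A i))) * prob (\<Union>i\<in>I. A i)"
proof -
  define s where "s = (\<Sum>i\<in>I. prob (A i))"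
  define U where "U = (\<Union>i\<in>I. A i)"
  define S :: "'a \<Rightarrow> real" where "S x = (\<Sum>i\<in>I. indicator (A i) x)" for x
  have U: "U \<in> events" unfolding U_def using assms by auto
  have s0: "0 \<le> s" unfolding s_def by (simp add: sum_nonneg)
  have ind: "integrable M (\<lambda>x. indicator B x :: real)" if "B \<in> events" for B
    using that by (simp add: integrable_indicator_iff emeasure_eq_measure)
  have S2: "S x * S x = (\<Sum>i\<in>I. \<Sum>j\<in>I. indicator (A i \<inter> A j) x)" for x
    unfolding S_def by (simp add: sum_product indicator_inter_arith)
  have int_S: "integrable M S" unfolding S_def
    by (intro Bochner_Integration.integrable_sum ind A)
  have int_S2: "integrable M (\<lambda>x. S x * S x)" unfolding S2
    by (intro Bochner_Integration.integrable_sum ind sets.Int A)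
  have E_S: "expectation S = s"
    unfolding S_def s_def using A ind by (subst Bochner_Integration.integral_sum) auto
  have "expectation (\<lambda>x. S x * S x) = (\<Sum>i\<in>I. \<Sum>j\<in>I. prob (A i \<inter> A j))"
    unfolding S2 using A
    by (simp add: Bochner_Integration.integral_sum Bochner_Integration.integrable_sum ind sets.Int)
  \<comment> \<open>Off the diagonal this is equality by independence. On the diagonal the
    intersection is \<open>A i\<close> itself, and the extra square
    \<open>prob (A i) * prob (A i)\<close> is added so that the double sum factors as
    \<open>s * s\<close>.\<close>
  also have "\<dots> \<le> (\<Sum>i\<in>I. \<Sum>j\<in>I. prob (A i) * prob (A j) + (if i = j then prob (A i) else 0))"
    by (intro sum_mono) (auto simp: indep)
  also have "\<dots> = s * s + s"
    unfolding s_def using \<open>finite I\<close> by (simp add: sum.distrib sum_product)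
  finally have E_S2: "expectation (\<lambda>x. S x * S x) \<le> s * s + s" .
  \<comment> \<open>\<open>S\<close> vanishes outside \<open>U\<close>, so the cross term of the
    square has an expectation known from \<open>E_S\<close>.\<close>
  have SU: "S x * indicator U x = S x" for x
    unfolding S_def U_def by (auto simp: indicator_def sum.neutral)
  \<comment> \<open>With a factor \<open>c\<close> in place of \<open>1 + s\<close>, the bound
    \<open>E_S2\<close> yields a lower bound \<open>(2 * c * s - s * s - s) / c^2\<close> for
    \<open>prob U\<close>; it is largest at \<open>c = 1 + s\<close>.\<close>
  have "0 \<le> expectation (\<lambda>x. (S x - (1 + s) * indicator U x)\<^sup>2)"
    by simp
  also have "(\<lambda>x. (S x - (1 + s) * indicator U x)\<^sup>2) =
      (\<lambda>x. S x * S x - 2 * (1 + s) * S x + (1 + s)\<^sup>2 * indicator U x)" (is "?f = ?g")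
  proof
    fix x
    have "?f x = S x * S x - 2 * (1 + s) * (S x * indicator U x)
        + (1 + s)\<^sup>2 * (indicator U x * indicator U x)"
      by (simp add: power2_eq_square algebra_simps)
    also have "indicator U x * indicator U x = (indicator U x :: real)"
      by (auto simp: indicator_def)
    finally show "?f x = ?g x" by (simp only: SU)
  qed
  also have "expectation \<dots> = expectation (\<lambda>x. S x * S x) - 2 * (1 + s) * s + (1 + s)\<^sup>2 * prob U"
    using int_S int_S2 ind[OF U] U by (simp add: E_S)
  also have "\<dots> \<le> s * s + s - 2 * (1 + s) * s + (1 + s)\<^sup>2 * prob U"
    using E_S2 by simp
  also have "\<dots> = (1 + s) * ((1 + s) * prob U - s)"
    by (simp add: power2_eq_square algebra_simps)
  finally show ?thesis
    using s0 by (simp add: zero_le_mult_iff s_def U_def)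
qed

text \<open>Layer cake formula: \<open>ennreal (f x)\<close> is the length of
  \<open>{0..<f x}\<close>, and the two integrals are swapped by Tonelli. Negative values of
  \<open>f\<close> are harmless, since \<open>ennreal\<close> sends them to 0 and the interval is
  then empty.\<close>

lemma (in sigma_finite_measure) nn_integral_eq_nn_integral_tail:
  fixes f :: "'a \<Rightarrow> real"
  assumes [measurable]: "f \<in> borel_measurable M"
  shows "(\<integral>\<^sup>+x. ennreal (f x) \<partial>M) =
    (\<integral>\<^sup>+t. emeasure M {x \<in> space M. t < f x} * indicator {0..} t \<partial>lborel)"
proof -
  interpret pair_sigma_finite M lborel ..
  have "(\<integral>\<^sup>+x. ennreal (f x) \<partial>M) = (\<integral>\<^sup>+x. (\<integral>\<^sup>+t. indicator {0..<f x} t \<partial>lborel) \<partial>M)"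
  proof (intro nn_integral_cong)
    show "ennreal (f x) = (\<integral>\<^sup>+t. indicator {0..<f x} t \<partial>lborel)" for x
      by (cases "0 \<le> f x") (auto simp: ennreal_neg)
  qed
  \<comment> \<open>The interval depends on \<open>x\<close>; written as a condition on
    \<open>x\<close> and \<open>t\<close> together, the integrand is visibly jointly
    measurable.\<close>
  also have "\<dots> = (\<integral>\<^sup>+x. (\<integral>\<^sup>+t. (if 0 \<le> t \<and> t < f x then 1 else 0) \<partial>lborel) \<partial>M)"
    by (intro nn_integral_cong) (auto simp: indicator_def)
  also have "\<dots> = (\<integral>\<^sup>+t. (\<integral>\<^sup>+x. (if 0 \<le> t \<and> t < f x then 1 else 0) \<partial>M) \<partial>lborel)"
    by (rule Fubini'[symmetric]) measurable
  also have "\<dots> = (\<integral>\<^sup>+t. emeasure M {x \<in> space M. t < f x} * indicator {0..} t \<partial>lborel)"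
  proof (intro nn_integral_cong)
    fix t :: real
    have "(\<integral>\<^sup>+x. (if 0 \<le> t \<and> t < f x then 1 else 0) \<partial>M) =
        (\<integral>\<^sup>+x. indicator {x \<in> space M. t < f x} x * indicator {0..} t \<partial>M)"
      by (intro nn_integral_cong) (auto simp: indicator_def)
    then show "(\<integral>\<^sup>+x. (if 0 \<le> t \<and> t < f x then 1 else 0) \<partial>M) =
        emeasure M {x \<in> space M. t < f x} * indicator {0..} t"
      by (simp add: nn_integral_multc)
  qed
  finally show ?thesis .
qed

theorem proposition4:
  fixes M :: "'a measure" and N :: "'b measure"
    and X :: "nat \<Rightarrow> 'a \<Rightarrow> real" and X' :: "nat \<Rightarrow> 'b \<Rightarrow> real"
    and n :: nat
  assumes "prob_space M" and "prob_space N"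
    and "n \<ge> 1"
    and "\<And>i. i \<in> {1..n} \<Longrightarrow> integrable M (X i)"
    and "\<And>i. i \<in> {1..n} \<Longrightarrow> AE x in M. 0 \<le> X i x"
    and "prob_space.indep_vars N (\<lambda>_. borel) X' {1..n}"
    and "\<And>i. i \<in> {1..n} \<Longrightarrow> distr N borel (X' i) = distr M borel (X i)"
    and "\<And>i j. i \<in> {1..n} \<Longrightarrow> j \<in> {1..n} \<Longrightarrow> i \<noteq> j \<Longrightarrow>
           prob_space.indep_var M borel (X i) borel (X j)"
  shows "(\<integral>x. (MAX i\<in>{1..n}. X i x) \<partial>M) \<ge> 1 / 2 * (\<integral>y. (MAX i\<in>{1..n}. X' i y) \<partial>N)"
proof -
  interpret M: prob_space M by fact
  interpret N: prob_space N by fact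
  let ?I = "{1..n}"
  have ne: "?I \<noteq> {}" using \<open>n \<ge> 1\<close> by simp
  define f where "f x = (MAX i\<in>?I. X i x)" for x
  define g where "g y = (MAX i\<in>?I. X' i y)" for y
  have X: "X i \<in> borel_measurable M" if "i \<in> ?I" for i
    using assms(4)[OF that] by simp
  have X': "X' i \<in> borel_measurable N" if "i \<in> ?I" for i
    using assms(6) that by (simp add: N.indep_vars_def2)
  have f_meas [measurable]: "f \<in> borel_measurable M"
    unfolding f_def by (intro borel_measurable_Max X) auto
  have g_meas [measurable]: "g \<in> borel_measurable N"
    unfolding g_def by (intro borel_measurable_Max X') auto
  have gt_f: "{x \<in> space M. t < f x} = (\<Union>i\<in>?I. {x \<in> space M. t < X i x})" for t
    unfolding f_def using ne by (auto simp: Max_gr_iff)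
  have gt_g: "{y \<in> space N. t < g y} = (\<Union>i\<in>?I. {y \<in> space N. t < X' i y})" for t
    unfolding g_def using ne by (auto simp: Max_gr_iff)
  have tail_eq: "N.prob {y \<in> space N. t < X' i y} = M.prob {x \<in> space M. t < X i x}"
    if "i \<in> ?I" for i t
  proof -
    have "measure (distr N borel (X' i)) {t<..} = measure (distr M borel (X i)) {t<..}"
      using assms(7)[OF that] by simp
    then show ?thesis
      using X[OF that] X'[OF that]
      by (simp add: measure_distr vimage_def Int_def conj_commute)
  qed
  have tail: "N.prob {y \<in> space N. t < g y} \<le> 2 * M.prob {x \<in> space M. t < f x}" for t
  proof -
    define A where "A i = {x \<in> space M. t < X i x}" for i
    have A: "A i \<in> M.events" if "i \<in> ?I" for i
      unfolding A_def using X[OF that] by measurable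
    have indep: "M.prob (A i \<inter> A j) = M.prob (A i) * M.prob (A j)"
      if "i \<in> ?I" "j \<in> ?I" "i \<noteq> j" for i j
      using M.indep_varD[OF assms(8)[OF that], of "{t<..}" "{t<..}"]
      by (simp add: A_def vimage_def Int_def conj_commute conj_left_commute)
    define s where "s = (\<Sum>i\<in>?I. M.prob (A i))"
    have s0: "0 \<le> s" unfolding s_def by (simp add: sum_nonneg)
    have *: "s \<le> (1 + s) * M.prob (\<Union>i\<in>?I. A i)"
      unfolding s_def using A indep by (intro M.sum_prob_le_prob_Union_pairwise) auto
    have "N.prob {y \<in> space N. t < g y} \<le> (\<Sum>i\<in>?I. N.prob {y \<in> space N. t < X' i y})"
      unfolding gt_g using X' by (intro N.finite_measure_subadditive_finite) auto
    also have "\<dots> = s"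
      unfolding s_def A_def by (intro sum.cong refl tail_eq)
    finally have "N.prob {y \<in> space N. t < g y} \<le> min 1 s"
      by simp
    also have "\<dots> \<le> 2 * M.prob (\<Union>i\<in>?I. A i)"
    proof (rule ccontr)
      \<comment> \<open>Arguing by contradiction allows multiplying by \<open>1 + s\<close> instead
        of dividing. The bound by \<open>2 * s\<close> below reads
        \<open>s + s * s \<le> 2 * s\<close> if \<open>s \<le> 1\<close>, and
        \<open>1 + s \<le> 2 * s\<close> otherwise.\<close>
      assume "\<not> ?thesis"
      then have "(1 + s) * (2 * M.prob (\<Union>i\<in>?I. A i)) < (1 + s) * min 1 s"
        using s0 by (intro mult_strict_left_mono) auto
      also have "\<dots> \<le> 2 * s"
        using s0 mult_left_le[of s s] by (cases "s \<le> 1") (auto simp: min_def algebra_simps)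
      finally show False using * by simp
    qed
    finally show ?thesis unfolding gt_f A_def .
  qed
  have nn: "(\<integral>\<^sup>+y. ennreal (g y) \<partial>N) \<le> 2 * (\<integral>\<^sup>+x. ennreal (f x) \<partial>M)"
  proof -
    have "(\<integral>\<^sup>+y. ennreal (g y) \<partial>N) \<le>
        (\<integral>\<^sup>+t. 2 * (emeasure M {x \<in> space M. t < f x} * indicator {0..} t) \<partial>lborel)"
      unfolding N.nn_integral_eq_nn_integral_tail[OF g_meas]
    proof (intro nn_integral_mono)
      fix t :: real
      have "ennreal (N.prob {y \<in> space N. t < g y}) \<le> 2 * ennreal (M.prob {x \<in> space M. t < f x})"
        using ennreal_leI[OF tail[of t]] by (simp add: ennreal_mult)
      then show "emeasure N {y \<in> space N. t < g y} * indicator {0..} t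
          \<le> 2 * (emeasure M {x \<in> space M. t < f x} * indicator {0..} t)"
        by (simp add: N.emeasure_eq_measure M.emeasure_eq_measure indicator_def)
    qed
    also have "\<dots> = 2 * (\<integral>\<^sup>+x. ennreal (f x) \<partial>M)"
      unfolding M.nn_integral_eq_nn_integral_tail[OF f_meas] by (intro nn_integral_cmult) measurable
    finally show ?thesis .
  qed
  \<comment> \<open>A maximum is nonnegative as soon as one of its members is; index 1 exists
    because \<open>n \<ge> 1\<close>. For \<open>X'\<close> the sign is read off from the common
    distribution.\<close>
  have X1: "AE x in M. 0 \<le> X 1 x"
    using assms(5)[of 1] \<open>n \<ge> 1\<close> by simp
  then have f_nonneg: "AE x in M. 0 \<le> f x"
    by eventually_elim (use ne in \<open>auto simp: f_def Max_ge_iff\<close>)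
  have "AE y in N. 0 \<le> X' 1 y"
  proof -
    have "AE z in distr M borel (X 1). 0 \<le> z"
      using X1 X[of 1] \<open>n \<ge> 1\<close> by (subst AE_distr_iff) auto
    also have "distr M borel (X 1) = distr N borel (X' 1)"
      using assms(7)[of 1] \<open>n \<ge> 1\<close> by simp
    finally show ?thesis
      using X'[of 1] \<open>n \<ge> 1\<close> by (subst (asm) AE_distr_iff) auto
  qed
  then have g_nonneg: "AE y in N. 0 \<le> g y"
    by eventually_elim (use ne in \<open>auto simp: g_def Max_ge_iff\<close>)
  have "integrable M f"
    unfolding f_def by (rule integrable_MAX) (use assms(4) ne in auto)
  \<comment> \<open>Finiteness matters because \<open>enn2real\<close> sends infinity to 0, so it is
    monotone only below a finite bound.\<close>
  then have fin: "(\<integral>\<^sup>+x. ennreal (f x) \<partial>M) < \<infinity>"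
    using f_nonneg by (simp add: integrable_iff_bounded nn_integral_eq_integral)
  \<comment> \<open>This equation does not presuppose integrability of \<open>g\<close>: in the
    infinite case both sides are 0 by convention.\<close>
  have "integral\<^sup>L N g = enn2real (\<integral>\<^sup>+y. ennreal (g y) \<partial>N)"
    by (intro integral_eq_nn_integral g_meas g_nonneg)
  also have "\<dots> \<le> enn2real (2 * (\<integral>\<^sup>+x. ennreal (f x) \<partial>M))"
    using fin by (intro enn2real_mono nn) (simp add: ennreal_mult_less_top)
  also have "\<dots> = 2 * integral\<^sup>L M f"
    using integral_eq_nn_integral[OF f_meas f_nonneg] by (simp add: enn2real_mult)
  finally show ?thesis by (simp add: f_def[abs_def] g_def[abs_def])
qed

end
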